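(* Let $A\in\mathbb{R}_\infty^{m\times n}$ be a matrix and let $S\subseteq\{1,\dots,n\}$ be any subset. (I) Exactly one of the following two statements is true: 1. There is a solution $\vec x\in\mathbb{R}_\infty^n$ to the tropical linear system $A\odot\vec x$ with finite coordinates $x_i$ for all $i\in S$. 2. There is $\vec z\in\mathbb{R}_\infty^m$ such that in each row of $A^T\odot\vec z$ the minimum is attained only once or is equal to $\infty$, for each two rows with finite minimum the (unique) minimums are in different columns, and for some $i\in S$ the $i$-th coordinate of $A^T\odot\vec z$ is finite. (II) Exactly one of the following two statements is true: 1. There is a solution $\vec x\in\mathbb{R}_\infty^n$ to the tropical linear system $A\odot\vec x$ such that for some $i\in S$ the coordinate $x_i$ is finite. 2. There is $\vec z\in\mathbb{R}_\infty^m$ such that in each row of $A^T\odot\vec z$ the minimum is attained only once or is equal to $\infty$, for each two rows with finite minimum the minimums are in different columns, and the $i$-th coordinates of $A^T\odot\vec z$ are finite for all $i\in S$.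
   Context: $\mathbb{R}_\infty=\mathbb{R}\cup\{+\infty\}$. A vector $\vec x\in\mathbb{R}_\infty^n$ is a solution of the tropical linear system $A\odot\vec x$, $A=(a_{ij})\in\mathbb{R}_\infty^{m\times n}$, if for each row $i$ the minimum $\min_j(a_{ij}+x_j)$ is attained for at least two different $j$ or equals $\infty$. For $\vec z\in\mathbb{R}_\infty^m$, the $i$-th row ($1\le i\le n$) of $A^T\odot\vec z$ is the family $(a_{ji}+z_j)_{1\le j\le m}$, whose members are indexed by the columns $j$ of $A^T$; the $i$-th coordinate of $A^T\odot\vec z$ is the minimum of this family. A finite minimum of row $i$ "is in column $j$" if it is attained at $j$. *)

theory Defs
  imports "HOL-Analysis.Analysis"
begin

text \<open>
  The tropical semiring carrier \<open>\<real> \<union> {+\<infinity>}\<close>, as the extended reals without \<open>-\<infinity>\<close>; on this set the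
  addition of \<^typ>\<open>ereal\<close> is the expected one (\<open>a + \<infinity> = \<infinity>\<close>).
\<close>

definition R_inf :: "ereal set" where
  "R_inf = {a. a \<noteq> - \<infinity>}"

definition R_inf_vec :: "(ereal ^ 'n) set" where
  "R_inf_vec = {x. \<forall>i. x $ i \<in> R_inf}"

definition R_inf_mat :: "(ereal ^ 'n ^ 'm) set" where
  "R_inf_mat = {A. \<forall>i j. A $ i $ j \<in> R_inf}"

definition trop_finite :: "ereal \<Rightarrow> bool" where
  "trop_finite a \<longleftrightarrow> \<bar>a\<bar> \<noteq> \<infinity>"

definition trop_entry :: "ereal ^ 'n ^ 'm \<Rightarrow> ereal ^ 'n \<Rightarrow> 'm \<Rightarrow> 'n \<Rightarrow> ereal" where
  "trop_entry A x i j = A $ i $ j + x $ j"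

definition trop_mult :: "ereal ^ 'n ^ 'm \<Rightarrow> ereal ^ 'n \<Rightarrow> ereal ^ 'm"  (infixr "\<odot>" 70) where
  "A \<odot> x = (\<chi> i. Min (range (trop_entry A x i)))"

definition min_in_column :: "ereal ^ 'n ^ 'm \<Rightarrow> ereal ^ 'n \<Rightarrow> 'm \<Rightarrow> 'n \<Rightarrow> bool" where
  "min_in_column A x i j \<longleftrightarrow> trop_entry A x i j = (A \<odot> x) $ i"

definition trop_solution :: "ereal ^ 'n ^ 'm \<Rightarrow> ereal ^ 'n \<Rightarrow> bool" where
  "trop_solution A x \<longleftrightarrow>
     (\<forall>i. (\<exists>j k. j \<noteq> k \<and> min_in_column A x i j \<and> min_in_column A x i k) \<or> (A \<odot> x) $ i = \<infinity>)"

definition unique_row_minima :: "ereal ^ 'n ^ 'm \<Rightarrow> ereal ^ 'n \<Rightarrow> bool" where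
  "unique_row_minima A x \<longleftrightarrow> (\<forall>i. (\<exists>!j. min_in_column A x i j) \<or> (A \<odot> x) $ i = \<infinity>)"

definition distinct_min_columns :: "ereal ^ 'n ^ 'm \<Rightarrow> ereal ^ 'n \<Rightarrow> bool" where
  "distinct_min_columns A x \<longleftrightarrow>
     (\<forall>i k. i \<noteq> k \<and> trop_finite ((A \<odot> x) $ i) \<and> trop_finite ((A \<odot> x) $ k) \<longrightarrow>
        (\<forall>j l. min_in_column A x i j \<and> min_in_column A x k l \<longrightarrow> j \<noteq> l))"

end

theory Submission imports Defs begin

text \<open>
  For a column \<open>j\<close> of \<open>A\<close>, call a vector \<open>x\<close> that solves \<open>A \<odot> x\<close> a primal witness if \<open>x\<^sub>j\<close> is finite,
  and a vector \<open>z\<close> as in the second alternatives a dual witness if the \<open>j\<close>-th coordinate of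
  \<open>A\<^sup>T \<odot> z\<close> is finite.  Both dichotomies follow from two facts.

  Weak duality (\<open>no_common_finite_coordinate\<close>): no column has a primal and a dual witness.  Let
  \<open>\<phi> k\<close> be the row in which column \<open>k\<close> of \<open>a\<^sub>i\<^sub>k + z\<^sub>i\<close> attains its unique minimum.  Starting at a
  common column \<open>j\<close>, row \<open>\<phi> j\<close> of \<open>A \<odot> x\<close> attains its minimum at some \<open>k \<noteq> j\<close>, which is again a common
  column; since \<open>\<phi> k \<noteq> \<phi> j\<close>, moving from \<open>j\<close> to \<open>k\<close> strictly decreases \<open>a\<^bsub>\<phi> j,j\<^esub> + z\<^bsub>\<phi> j\<^esub> + x\<^sub>j\<close>.
  With finitely many columns this cannot go on.

  Complementarity (\<open>complementary_witnesses\<close>): there are one solution \<open>x\<close> and one dual vector \<open>z\<close>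
  such that every column is finite for \<open>x\<close> or for \<open>z\<close>.  Being a solution means \<open>F x \<le> x\<close> for the monotone map
  \<open>(F x)\<^sub>j = max\<^sub>i (min\<^bsub>k \<noteq> j\<^esub> (a\<^sub>i\<^sub>k + x\<^sub>k) - a\<^sub>i\<^sub>j)\<close>, the maximum running over the rows with finite
  \<open>a\<^sub>i\<^sub>j\<close>.  Iterate \<open>x \<mapsto> max 0 (F x - 1/t)\<close>, truncated at height \<open>t\<close>, from \<open>0\<close>.  The iterates increase, and their
  limit \<open>x\<close> is a solution.  At a late stage \<open>y\<close>, all coordinates in the set \<open>J\<close> of columns where the
  limit is \<open>\<infinity>\<close> are positive and very large.  There positivity gives \<open>y\<^sub>j < (F y)\<^sub>j\<close>, which says that some row \<open>\<phi> j\<close> of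
  \<open>a\<^sub>i\<^sub>k + y\<^sub>k\<close> has its unique minimum in column \<open>j\<close>.  Largeness forces such a row to be \<open>\<infinity>\<close> outside \<open>J\<close>.
  Setting \<open>z\<^bsub>\<phi> j\<^esub> = - (a\<^bsub>\<phi> j,j\<^esub> + y\<^sub>j)\<close>, and \<open>z\<^sub>i = \<infinity>\<close> on all other rows, makes those row minima
  equal to \<open>0\<close> in \<open>a\<^sub>i\<^sub>k + y\<^sub>k + z\<^sub>i\<close>, so that \<open>0\<close> at \<open>\<phi> j\<close> is also the unique minimum of each column \<open>j \<in> J\<close>.
\<close>

section \<open>Minima of tropical rows\<close>

lemma trop_mult_le: "(A \<odot> x) $ i \<le> trop_entry A x i j"
  by (simp add: trop_mult_def)

lemma trop_mult_attained: "\<exists>j. min_in_column A x i j"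
proof -
  have "Min (range (trop_entry A x i)) \<in> range (trop_entry A x i)"
    by (rule Min_in) auto
  then show ?thesis
    by (metis imageE min_in_column_def trop_mult_def vec_lambda_beta)
qed

lemma min_in_column_iff:
  "min_in_column A x i j \<longleftrightarrow> (\<forall>k. trop_entry A x i j \<le> trop_entry A x i k)"
  by (metis antisym min_in_column_def trop_mult_attained trop_mult_le)

lemma trop_mult_eq_infinity_iff:
  "(A \<odot> x) $ i = \<infinity> \<longleftrightarrow> (\<forall>j. trop_entry A x i j = \<infinity>)"
  by (metis ereal_infty_less_eq(1) min_in_column_def trop_mult_attained trop_mult_le)

lemma trop_entry_transpose: "trop_entry (transpose A) z j i = A $ i $ j + z $ i"
  by (simp add: trop_entry_def transpose_def)

lemma trop_entry_in_R_inf: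
  assumes "A \<in> R_inf_mat" "x \<in> R_inf_vec"
  shows "trop_entry A x i j \<noteq> - \<infinity>"
  using assms by (auto simp: trop_entry_def R_inf_mat_def R_inf_vec_def R_inf_def)

lemma trop_finite_coordinate_iff:
  assumes "A \<in> R_inf_mat" "x \<in> R_inf_vec"
  shows "trop_finite ((A \<odot> x) $ i) \<longleftrightarrow> (\<exists>j. trop_entry A x i j \<noteq> \<infinity>)"
proof -
  have "(A \<odot> x) $ i \<noteq> - \<infinity>"
    by (metis assms min_in_column_def trop_entry_in_R_inf trop_mult_attained)
  then show ?thesis
    using trop_mult_eq_infinity_iff[of A x i] unfolding trop_finite_def
    by (cases "(A \<odot> x) $ i") auto
qed

lemma transpose_in_R_inf_mat: "A \<in> R_inf_mat \<Longrightarrow> transpose A \<in> R_inf_mat"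
  by (simp add: R_inf_mat_def transpose_def)

lemma trop_solutionI:
  assumes "\<And>i j. trop_entry A x i j \<noteq> \<infinity> \<Longrightarrow> \<exists>k. k \<noteq> j \<and> trop_entry A x i k \<le> trop_entry A x i j"
  shows "trop_solution A x"
  unfolding trop_solution_def
proof
  fix i
  obtain j where j: "min_in_column A x i j"
    using trop_mult_attained by blast
  show "(\<exists>j k. j \<noteq> k \<and> min_in_column A x i j \<and> min_in_column A x i k) \<or> (A \<odot> x) $ i = \<infinity>"
  proof (cases "trop_entry A x i j = \<infinity>")
    case True
    then show ?thesis using j by (simp add: min_in_column_def)
  next
    case False
    then obtain k where "k \<noteq> j" "trop_entry A x i k \<le> trop_entry A x i j"
      using assms by blast
    then have "min_in_column A x i k"
      using j by (meson min_in_column_iff order_trans)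
    then show ?thesis using j \<open>k \<noteq> j\<close> by blast
  qed
qed

section \<open>Weak duality\<close>

text \<open>
  The descent: the minimum of row \<open>\<phi> j\<close> is also attained at some column \<open>k\<close> other than \<open>j\<close>, and the unique
  minimum of column \<open>k\<close> lies in another row, hence strictly below the entry at row \<open>\<phi> j\<close>.
\<close>

lemma no_common_finite_coordinate:
  fixes A :: "ereal ^ 'n ^ 'm"
  assumes A: "A \<in> R_inf_mat" and x: "x \<in> R_inf_vec" and z: "z \<in> R_inf_vec"
    and sol: "trop_solution A x"
    and uniq: "unique_row_minima (transpose A) z"
    and dist: "distinct_min_columns (transpose A) z"
    and xj: "trop_finite (x $ j)" and zj: "trop_finite ((transpose A \<odot> z) $ j)"
  shows False
proof -
  define K where "K = {k. trop_finite (x $ k) \<and> trop_finite ((transpose A \<odot> z) $ k)}"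
  have "\<forall>k. \<exists>i. min_in_column (transpose A) z k i"
    using trop_mult_attained by blast
  then obtain \<phi> where \<phi>: "\<And>k. min_in_column (transpose A) z k (\<phi> k)"
    by metis
  define g where "g k = A $ \<phi> k $ k + z $ \<phi> k + x $ k" for k
  have "\<exists>k\<in>K. g k < g j" if "j \<in> K" for j
  proof -
    let ?i = "\<phi> j"
    have fin: "trop_finite (x $ j)" "trop_finite (A $ ?i $ j + z $ ?i)"
      using that \<phi>[of j] by (auto simp: K_def min_in_column_def trop_entry_transpose)
    have ge: "A $ i $ k \<noteq> - \<infinity> \<and> z $ i \<noteq> - \<infinity> \<and> x $ k \<noteq> - \<infinity>" for i k
      using A x z by (auto simp: R_inf_mat_def R_inf_vec_def R_inf_def)
    obtain a c b where abc: "A $ ?i $ j = ereal a" "z $ ?i = ereal c" "x $ j = ereal b"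
      using fin ge[of ?i j] by (cases "A $ ?i $ j"; cases "z $ ?i"; cases "x $ j")
        (auto simp: trop_finite_def)
    then have "trop_entry A x ?i j = ereal (a + b)"
      by (simp add: trop_entry_def)
    then have "(A \<odot> x) $ ?i \<noteq> \<infinity>"
      by (auto simp: trop_mult_eq_infinity_iff intro: exI[of _ j])
    then obtain k where k: "k \<noteq> j" "min_in_column A x ?i k"
      using sol unfolding trop_solution_def by metis
    then have le: "A $ ?i $ k + x $ k \<le> ereal (a + b)"
      using abc by (auto simp: min_in_column_iff trop_entry_def dest: spec[of _ j])
    then obtain a' b' where ab': "A $ ?i $ k = ereal a'" "x $ k = ereal b'"
      using ge[of ?i k] by (cases "A $ ?i $ k"; cases "x $ k") auto
    have zk: "trop_finite ((transpose A \<odot> z) $ k)"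
      using abc ab' by (auto simp: trop_finite_coordinate_iff transpose_in_R_inf_mat A z
          trop_entry_transpose intro!: exI[of _ ?i])
    have "k \<in> K"
      using zk ab' by (simp add: K_def trop_finite_def)
    have "\<phi> k \<noteq> ?i"
      using dist \<phi> k(1) zk that unfolding distinct_min_columns_def K_def by blast
    moreover have "\<exists>!i. min_in_column (transpose A) z k i"
      using uniq zk unfolding unique_row_minima_def by (metis abs_ereal.simps(3) trop_finite_def)
    ultimately have "\<not> min_in_column (transpose A) z k ?i"
      using \<phi> by blast
    then have "A $ \<phi> k $ k + z $ \<phi> k < A $ ?i $ k + z $ ?i"
      using \<phi>[of k] by (metis min_in_column_def order_le_less trop_entry_transpose trop_mult_le)
    then have "g k < g j"
      using le abc ab' ge[of "\<phi> k" k] unfolding g_def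
      by (cases "A $ \<phi> k $ k"; cases "z $ \<phi> k") auto
    then show ?thesis using \<open>k \<in> K\<close> by blast
  qed
  moreover have "\<exists>k\<in>K. \<forall>l\<in>K. g k \<le> g l"
    using xj zj finite[of K] by (metis (mono_tags, lifting) K_def arg_min_least
        arg_min_if_finite(1) empty_iff mem_Collect_eq)
  ultimately show False by (meson leD)
qed

section \<open>The ascending iteration\<close>

text \<open>
  \<open>lift A t w i j\<close> is the truncation at height \<open>t + 1\<close> of \<open>min\<^bsub>k \<noteq> j\<^esub> (a\<^sub>i\<^sub>k + w\<^sub>k) - a\<^sub>i\<^sub>j - 1 / (t + 1)\<close>:
  the height to which row \<open>i\<close> raises coordinate \<open>j\<close>.  Truncation keeps the iterates real also where
  the inner minimum is \<open>\<infinity>\<close>.  The cap tends to \<open>\<infinity>\<close> and the discount \<open>1 / (t + 1)\<close> to \<open>0\<close>, so neither is visible in the limit,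
  while each single stage keeps a positive margin.
\<close>

definition lift :: "ereal ^ 'n ^ 'm \<Rightarrow> nat \<Rightarrow> ('n \<Rightarrow> real) \<Rightarrow> 'm \<Rightarrow> 'n \<Rightarrow> real" where
  "lift A t w i j = Min (insert (real (Suc t))
     ((\<lambda>k. real_of_ereal (A $ i $ k) + w k - real_of_ereal (A $ i $ j) - 1 / real (Suc t))
        ` {k. k \<noteq> j \<and> A $ i $ k \<noteq> \<infinity>}))"

primrec ascent :: "ereal ^ 'n ^ 'm \<Rightarrow> nat \<Rightarrow> 'n \<Rightarrow> real" where
  "ascent A 0 = (\<lambda>j. 0)"
| "ascent A (Suc t) = (\<lambda>j. Max (insert 0 ((\<lambda>i. lift A t (ascent A t) i j) ` {i. A $ i $ j \<noteq> \<infinity>})))"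

lemma lift_mono:
  assumes "t \<le> t'" and "\<And>k. w k \<le> w' k"
  shows "lift A t w i j \<le> lift A t' w' i j"
proof -
  have disc: "1 / real (Suc t') \<le> 1 / real (Suc t)"
    using assms(1) by (simp add: frac_le)
  have "lift A t w i j \<le> real (Suc t)"
    by (simp add: lift_def)
  then have "lift A t w i j \<le> real (Suc t')"
    using assms(1) by simp
  moreover have "lift A t w i j
      \<le> real_of_ereal (A $ i $ k) + w' k - real_of_ereal (A $ i $ j) - 1 / real (Suc t')"
    if "k \<noteq> j" "A $ i $ k \<noteq> \<infinity>" for k
  proof -
    have "lift A t w i j
      \<le> real_of_ereal (A $ i $ k) + w k - real_of_ereal (A $ i $ j) - 1 / real (Suc t)"
      unfolding lift_def using that by (intro Min_le) auto
    then show ?thesis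
      using assms(2)[of k] disc by linarith
  qed
  ultimately show ?thesis
    unfolding lift_def[of A t'] by (subst Min_ge_iff) auto
qed

lemma ascent_nonneg: "0 \<le> ascent A t j"
  by (cases t) auto

lemma ascent_le_Suc: "ascent A t j \<le> ascent A (Suc t) j"
proof (induction t arbitrary: j)
  case 0
  show ?case using ascent_nonneg[of A "Suc 0" j] by simp
next
  case (Suc t)
  have "x \<le> ascent A (Suc (Suc t)) j"
    if "x \<in> insert 0 ((\<lambda>i. lift A t (ascent A t) i j) ` {i. A $ i $ j \<noteq> \<infinity>})" for x
    using that
  proof
    assume "x = 0"
    then show ?thesis by (simp only: ascent_nonneg)
  next
    assume "x \<in> (\<lambda>i. lift A t (ascent A t) i j) ` {i. A $ i $ j \<noteq> \<infinity>}"
    then obtain i where i: "A $ i $ j \<noteq> \<infinity>" and "x = lift A t (ascent A t) i j"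
      by blast
    then have "x \<le> lift A (Suc t) (ascent A (Suc t)) i j"
      using Suc lift_mono[of t "Suc t"] by (metis le_SucI order_refl)
    also have "\<dots> \<le> ascent A (Suc (Suc t)) j"
      using i unfolding ascent.simps(2)[of A "Suc t"] by (intro Max_ge) auto
    finally show ?thesis .
  qed
  then show ?case
    unfolding ascent.simps(2)[of A t] by (subst Max_le_iff) auto
qed

lemma ascent_mono: "s \<le> t \<Longrightarrow> ascent A s j \<le> ascent A t j"
  by (rule lift_Suc_mono_le[of "\<lambda>t. ascent A t j"]) (rule ascent_le_Suc)

text \<open>
  Below the cap, each stage satisfies the inequalities that define a solution up to the discount, with the
  previous stage on the left; in the limit these become \<open>F x \<le> x\<close>.
\<close>

lemma ascent_almost_solution:
  assumes "A $ i $ j \<noteq> \<infinity>" and "ascent A (Suc t) j < real (Suc t)"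
  obtains k where "k \<noteq> j" "A $ i $ k \<noteq> \<infinity>"
    "real_of_ereal (A $ i $ k) + ascent A t k
       \<le> real_of_ereal (A $ i $ j) + ascent A (Suc t) j + 1 / real (Suc t)"
proof -
  let ?M = "insert (real (Suc t)) ((\<lambda>k. real_of_ereal (A $ i $ k) + ascent A t k
      - real_of_ereal (A $ i $ j) - 1 / real (Suc t)) ` {k. k \<noteq> j \<and> A $ i $ k \<noteq> \<infinity>})"
  have "lift A t (ascent A t) i j \<in> ?M"
    unfolding lift_def by (intro Min_in) auto
  moreover have le: "lift A t (ascent A t) i j \<le> ascent A (Suc t) j"
    using assms(1) by (auto intro: Max_ge)
  ultimately obtain k where k: "k \<noteq> j" "A $ i $ k \<noteq> \<infinity>"
    "lift A t (ascent A t) i j = real_of_ereal (A $ i $ k) + ascent A t k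
       - real_of_ereal (A $ i $ j) - 1 / real (Suc t)"
    using assms(2) by auto
  show thesis
    using k(3) le by (intro that[OF k(1,2)]) linarith
qed

text \<open>
  A positive coordinate was raised by some row, and the raising row has its strict minimum there.  Passing from stage \<open>t\<close> to
  stage \<open>t + 1\<close> in the other coordinates only increases the right-hand side.
\<close>

lemma ascent_strict_row:
  assumes "0 < ascent A (Suc t) j"
  obtains i where "A $ i $ j \<noteq> \<infinity>"
    "\<And>k. k \<noteq> j \<Longrightarrow> A $ i $ k \<noteq> \<infinity> \<Longrightarrow>
       real_of_ereal (A $ i $ j) + ascent A (Suc t) j
         < real_of_ereal (A $ i $ k) + ascent A (Suc t) k"
proof -
  have "ascent A (Suc t) j \<in> insert 0 ((\<lambda>i. lift A t (ascent A t) i j) ` {i. A $ i $ j \<noteq> \<infinity>})"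
    unfolding ascent.simps(2) by (intro Max_in) auto
  then obtain i where i: "A $ i $ j \<noteq> \<infinity>" "ascent A (Suc t) j = lift A t (ascent A t) i j"
    using assms by auto
  show thesis
  proof (rule that[OF i(1)])
    fix k assume k: "k \<noteq> j" "A $ i $ k \<noteq> \<infinity>"
    have "ascent A (Suc t) j
        \<le> real_of_ereal (A $ i $ k) + ascent A t k - real_of_ereal (A $ i $ j) - 1 / real (Suc t)"
      unfolding i(2) lift_def using k by (intro Min_le) auto
    moreover have "0 < 1 / real (Suc t)" by simp
    ultimately show "real_of_ereal (A $ i $ j) + ascent A (Suc t) j
         < real_of_ereal (A $ i $ k) + ascent A (Suc t) k"
      using ascent_le_Suc[of A t k] by linarith
  qed
qed

section \<open>The limit and a late stage of the iteration\<close>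

definition ascent_limit :: "ereal ^ 'n ^ 'm \<Rightarrow> ereal ^ 'n" where
  "ascent_limit A = (\<chi> j. SUP t. ereal (ascent A t j))"

lemma ascent_le_limit: "ereal (ascent A t j) \<le> ascent_limit A $ j"
  by (auto simp: ascent_limit_def intro: SUP_upper)

lemma ascent_limit_nonneg: "0 \<le> ascent_limit A $ j"
  using ascent_le_limit[of A 0 j] by (simp add: zero_ereal_def)

lemma ascent_limit_in_R_inf_vec: "ascent_limit A \<in> R_inf_vec"
  unfolding R_inf_vec_def R_inf_def mem_Collect_eq
proof
  fix j
  show "ascent_limit A $ j \<noteq> - \<infinity>"
    using ascent_limit_nonneg[of A j] by auto
qed

lemma ascent_limit_solution:
  fixes A :: "ereal ^ 'n ^ 'm"
  assumes A: "A \<in> R_inf_mat"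
  shows "trop_solution A (ascent_limit A)"
proof (rule trop_solutionI)
  fix i j
  assume "trop_entry A (ascent_limit A) i j \<noteq> \<infinity>"
  then have fin: "A $ i $ j \<noteq> \<infinity>" "ascent_limit A $ j \<noteq> \<infinity>"
    by (auto simp: trop_entry_def)
  define a where "a k = real_of_ereal (A $ i $ k)" for k
  have a: "A $ i $ k = ereal (a k)" if "A $ i $ k \<noteq> \<infinity>" for k
    using that A by (cases "A $ i $ k") (auto simp: a_def R_inf_mat_def R_inf_def)
  obtain b where b: "ascent_limit A $ j = ereal b"
    using fin(2) ascent_limit_nonneg[of A j] by (cases "ascent_limit A $ j") auto
  have le_b: "ascent A t j \<le> b" for t
    using ascent_le_limit[of A t j] b by simp
  have "\<exists>k. k \<noteq> j \<and> A $ i $ k \<noteq> \<infinity> \<and> a k + ascent A t k \<le> a j + b + 1 / real (Suc t)"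
    if "b < real t" for t
  proof -
    have "ascent A (Suc t) j < real (Suc t)"
      using le_b[of "Suc t"] that by (simp del: ascent.simps)
    from ascent_almost_solution[OF fin(1) this] obtain k where "k \<noteq> j" "A $ i $ k \<noteq> \<infinity>"
      "a k + ascent A t k \<le> a j + ascent A (Suc t) j + 1 / real (Suc t)"
      unfolding a_def by blast
    then show ?thesis using le_b[of "Suc t"] by (intro exI[of _ k]) linarith
  qed
  then have "\<forall>t. \<exists>k. b < real t \<longrightarrow>
      k \<noteq> j \<and> A $ i $ k \<noteq> \<infinity> \<and> a k + ascent A t k \<le> a j + b + 1 / real (Suc t)"
    by blast
  then obtain \<kappa> where \<kappa>: "\<And>t. b < real t \<Longrightarrow> \<kappa> t \<noteq> j \<and> A $ i $ \<kappa> t \<noteq> \<infinity> \<and>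
      a (\<kappa> t) + ascent A t (\<kappa> t) \<le> a j + b + 1 / real (Suc t)"
    by metis
  \<comment> \<open>The competing column may vary with the stage, but one of them serves infinitely many stages.\<close>
  obtain k where k: "infinite {t. \<kappa> t = k}"
    using pigeonhole_infinite[of "UNIV :: nat set" \<kappa>] by auto
  have late: "\<exists>t\<ge>s. b < real t \<and> \<kappa> t = k" for s
  proof -
    obtain r where "b < real r" using reals_Archimedean2 by blast
    moreover obtain t where "max r s < t" "\<kappa> t = k"
      using k by (metis (mono_tags, lifting) infinite_nat_iff_unbounded mem_Collect_eq)
    ultimately show ?thesis by (intro exI[of _ t]) auto
  qed
  then have k': "k \<noteq> j" "A $ i $ k \<noteq> \<infinity>"
    using \<kappa> by blast+
  have bound: "ascent A s k \<le> a j + b - a k" for s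
  proof (rule field_le_epsilon)
    fix e :: real assume "0 < e"
    then obtain r where r: "inverse (real (Suc r)) < e"
      using reals_Archimedean by blast
    obtain t where t: "max r s \<le> t" "b < real t" "\<kappa> t = k"
      using late by blast
    have "1 / real (Suc t) \<le> inverse (real (Suc r))"
      using t(1) by (simp add: inverse_eq_divide frac_le)
    moreover have "ascent A s k \<le> ascent A t k"
      using t(1) by (intro ascent_mono) simp
    ultimately show "ascent A s k \<le> a j + b - a k + e"
      using \<kappa>[OF t(2)] t(3) r by auto
  qed
  have "ascent_limit A $ k \<le> ereal (a j + b - a k)"
    using bound by (auto simp: ascent_limit_def intro: SUP_least)
  then have "trop_entry A (ascent_limit A) i k \<le> trop_entry A (ascent_limit A) i j"
    using a[OF fin(1)] a[OF k'(2)] b by (cases "ascent_limit A $ k") (auto simp: trop_entry_def)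
  then show "\<exists>k. k \<noteq> j \<and> trop_entry A (ascent_limit A) i k \<le> trop_entry A (ascent_limit A) i j"
    using k'(1) by blast
qed

lemma ascent_eventually_large:
  fixes A :: "ereal ^ 'n ^ 'm"
  shows "\<exists>t. \<forall>j. ascent_limit A $ j = \<infinity> \<longrightarrow> C < ascent A (Suc t) j"
proof -
  have "\<exists>s. ascent_limit A $ j = \<infinity> \<longrightarrow> C < ascent A s j" for j
  proof (cases "ascent_limit A $ j = \<infinity>")
    case True
    then have "ereal C < (SUP t. ereal (ascent A t j))"
      by (simp add: ascent_limit_def)
    then show ?thesis by (auto simp: less_SUP_iff)
  qed simp
  then obtain s where s: "\<And>j. ascent_limit A $ j = \<infinity> \<Longrightarrow> C < ascent A (s j) j"
    by metis
  define t where "t = Max (range s)"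
  have "s j \<le> Suc t" for j
    by (simp add: t_def le_SucI)
  then show ?thesis
    using s ascent_mono less_le_trans by (intro exI[of _ t]) blast
qed

text \<open>
  Late stages separate the divergent columns from the others: a row with a finite entry outside \<open>J\<close> has
  its minimum bounded along the whole iteration, by the constant \<open>C\<close> up to the entry at \<open>j\<close>, so it cannot have a
  minimum at a column \<open>j \<in> J\<close> whose coordinate has passed \<open>C\<close>.
\<close>

lemma divergent_columns_strict_rows:
  fixes A :: "ereal ^ 'n ^ 'm"
  defines "J \<equiv> {j. ascent_limit A $ j = \<infinity>}"
  obtains y :: "'n \<Rightarrow> real" and \<phi> :: "'n \<Rightarrow> 'm"
  where "\<And>j. j \<in> J \<Longrightarrow> A $ \<phi> j $ j \<noteq> \<infinity>"
    and "\<And>j k. j \<in> J \<Longrightarrow> k \<notin> J \<Longrightarrow> A $ \<phi> j $ k = \<infinity>"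
    and "\<And>j k. j \<in> J \<Longrightarrow> k \<noteq> j \<Longrightarrow> A $ \<phi> j $ k \<noteq> \<infinity> \<Longrightarrow>
           real_of_ereal (A $ \<phi> j $ j) + y j < real_of_ereal (A $ \<phi> j $ k) + y k"
proof -
  define f where "f = (\<lambda>(i, j, k). real_of_ereal (A $ i $ k)
      + real_of_ereal (ascent_limit A $ k) - real_of_ereal (A $ i $ j))"
  define C where "C = Max (insert 0 (range f))"
  have "finite (insert 0 (range f))"
    by simp
  then have C: "0 \<le> C" "f p \<le> C" for p
    unfolding C_def by (simp_all only: Max_ge insertI1 insertI2 rangeI)
  obtain t where t: "\<And>j. j \<in> J \<Longrightarrow> C < ascent A (Suc t) j"
    using ascent_eventually_large[of A C] by (auto simp: J_def simp del: ascent.simps)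
  define y where "y = ascent A (Suc t)"
  have "\<forall>j\<in>J. \<exists>i. A $ i $ j \<noteq> \<infinity> \<and> (\<forall>k. k \<noteq> j \<longrightarrow> A $ i $ k \<noteq> \<infinity> \<longrightarrow>
      real_of_ereal (A $ i $ j) + y j < real_of_ereal (A $ i $ k) + y k)"
  proof
    fix j assume "j \<in> J"
    then have "0 < ascent A (Suc t) j"
      using t C(1) by (meson le_less_trans)
    then show "\<exists>i. A $ i $ j \<noteq> \<infinity> \<and> (\<forall>k. k \<noteq> j \<longrightarrow> A $ i $ k \<noteq> \<infinity> \<longrightarrow>
        real_of_ereal (A $ i $ j) + y j < real_of_ereal (A $ i $ k) + y k)"
      unfolding y_def using ascent_strict_row[of A t j] by blast
  qed
  then obtain \<phi> where \<phi>: "\<And>j. j \<in> J \<Longrightarrow> A $ \<phi> j $ j \<noteq> \<infinity>"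
    "\<And>j k. j \<in> J \<Longrightarrow> k \<noteq> j \<Longrightarrow> A $ \<phi> j $ k \<noteq> \<infinity> \<Longrightarrow>
       real_of_ereal (A $ \<phi> j $ j) + y j < real_of_ereal (A $ \<phi> j $ k) + y k"
    by metis
  have "A $ \<phi> j $ k = \<infinity>" if "j \<in> J" "k \<notin> J" for j k
  proof (rule ccontr)
    assume "A $ \<phi> j $ k \<noteq> \<infinity>"
    with that have "real_of_ereal (A $ \<phi> j $ j) + y j < real_of_ereal (A $ \<phi> j $ k) + y k"
      using \<phi>(2) by metis
    moreover have "y k \<le> real_of_ereal (ascent_limit A $ k)"
      using ascent_le_limit[of A "Suc t" k] that(2) ascent_limit_nonneg[of A k]
      by (cases "ascent_limit A $ k") (auto simp: J_def y_def)
    ultimately show False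
      using C(2)[of "(\<phi> j, j, k)"] t[OF that(1)] by (simp add: f_def y_def del: ascent.simps)
  qed
  with \<phi> show thesis
    by (intro that[of \<phi> y]; simp)
qed

section \<open>Complementary witnesses\<close>

text \<open>
  Normalising the strict row minima to \<open>0\<close> turns them into strict column minima: at column \<open>j\<close> the row
  \<open>\<phi> j\<close> contributes \<open>0\<close>, and every other row \<open>\<phi> l\<close> contributes a positive number because its \<open>0\<close> is at \<open>l\<close>.
\<close>

lemma dual_vector_of_strict_rows:
  fixes A :: "ereal ^ 'n ^ 'm" and J :: "'n set"
  assumes A: "A \<in> R_inf_mat"
    and fin: "\<And>j. j \<in> J \<Longrightarrow> A $ \<phi> j $ j \<noteq> \<infinity>"
    and outside: "\<And>j k. j \<in> J \<Longrightarrow> k \<notin> J \<Longrightarrow> A $ \<phi> j $ k = \<infinity>"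
    and strict: "\<And>j k. j \<in> J \<Longrightarrow> k \<noteq> j \<Longrightarrow> A $ \<phi> j $ k \<noteq> \<infinity> \<Longrightarrow>
           real_of_ereal (A $ \<phi> j $ j) + y j < real_of_ereal (A $ \<phi> j $ k) + y k"
  obtains z where "z \<in> R_inf_vec" "unique_row_minima (transpose A) z"
    "distinct_min_columns (transpose A) z" "\<And>j. j \<in> J \<Longrightarrow> trop_finite ((transpose A \<odot> z) $ j)"
proof -
  define a where "a i k = real_of_ereal (A $ i $ k)" for i k
  have a: "A $ i $ k = ereal (a i k)" if "A $ i $ k \<noteq> \<infinity>" for i k
    using that A by (cases "A $ i $ k") (auto simp: a_def R_inf_mat_def R_inf_def)
  have inj: "inj_on \<phi> J"
  proof (rule inj_onI, rule ccontr)
    fix j k assume "j \<in> J" "k \<in> J" "\<phi> j = \<phi> k" "j \<noteq> k"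
    then show False
      using strict[of j k] strict[of k j] fin[of j] fin[of k] by simp
  qed
  define z :: "ereal ^ 'm" where
    "z = (\<chi> i. if i \<in> \<phi> ` J
               then ereal (- (a i (inv_into J \<phi> i) + y (inv_into J \<phi> i))) else \<infinity>)"
  have z\<phi>: "z $ \<phi> j = ereal (- (a (\<phi> j) j + y j))" if "j \<in> J" for j
    using that inj by (simp add: z_def)
  have zinf: "z $ i = \<infinity>" if "i \<notin> \<phi> ` J" for i
    using that by (simp add: z_def)
  have zR: "z \<in> R_inf_vec"
    by (auto simp: R_inf_vec_def R_inf_def z_def)
  let ?e = "trop_entry (transpose A) z"
  have diag: "?e j (\<phi> j) = ereal (- y j)" if "j \<in> J" for j
    using that a[OF fin[OF that]] by (simp add: trop_entry_transpose z\<phi>)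
  have off: "ereal (- y j) < ?e j i" if "j \<in> J" "i \<noteq> \<phi> j" for i j
  proof (cases "i \<in> \<phi> ` J \<and> A $ i $ j \<noteq> \<infinity>")
    case True
    then obtain l where l: "l \<in> J" "i = \<phi> l" by blast
    have "a (\<phi> l) l + y l < a (\<phi> l) j + y j"
      unfolding a_def using strict[of l j] l that True by blast
    then show ?thesis
      using l True a[of i j] by (simp add: trop_entry_transpose z\<phi>)
  next
    case False
    then have "?e j i = \<infinity>"
      using zinf by (auto simp: trop_entry_transpose)
    then show ?thesis by simp
  qed
  have inf: "?e j i = \<infinity>" if "j \<notin> J" for i j
    using that outside zinf by (cases "i \<in> \<phi> ` J") (auto simp: trop_entry_transpose)
  have min: "min_in_column (transpose A) z j i \<longleftrightarrow> i = \<phi> j" if "j \<in> J" for i j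
    unfolding min_in_column_iff using that diag off by (metis leD order_le_less)
  have J: "trop_finite ((transpose A \<odot> z) $ j) \<longleftrightarrow> j \<in> J" for j
    using diag[of j] inf[of j]
    by (auto simp: trop_finite_coordinate_iff transpose_in_R_inf_mat A zR intro: exI[of _ "\<phi> j"])
  have "unique_row_minima (transpose A) z"
    unfolding unique_row_minima_def
  proof
    fix j
    show "(\<exists>!i. min_in_column (transpose A) z j i) \<or> (transpose A \<odot> z) $ j = \<infinity>"
      using min[of j] inf[of j] by (cases "j \<in> J") (auto simp: trop_mult_eq_infinity_iff)
  qed
  moreover have "distinct_min_columns (transpose A) z"
    unfolding distinct_min_columns_def J using min inj by (metis inj_onD)
  ultimately show thesis
    using that zR J by blast
qed

lemma complementary_witnesses:
  fixes A :: "ereal ^ 'n ^ 'm"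
  assumes "A \<in> R_inf_mat"
  obtains x z where "x \<in> R_inf_vec" "trop_solution A x"
    "z \<in> R_inf_vec" "unique_row_minima (transpose A) z" "distinct_min_columns (transpose A) z"
    "\<And>j. trop_finite (x $ j) \<or> trop_finite ((transpose A \<odot> z) $ j)"
proof -
  let ?J = "{j. ascent_limit A $ j = \<infinity>}"
  obtain y :: "'n \<Rightarrow> real" and \<phi> :: "'n \<Rightarrow> 'm" where
    "\<And>j. j \<in> ?J \<Longrightarrow> A $ \<phi> j $ j \<noteq> \<infinity>"
    "\<And>j k. j \<in> ?J \<Longrightarrow> k \<notin> ?J \<Longrightarrow> A $ \<phi> j $ k = \<infinity>"
    "\<And>j k. j \<in> ?J \<Longrightarrow> k \<noteq> j \<Longrightarrow> A $ \<phi> j $ k \<noteq> \<infinity> \<Longrightarrow>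
       real_of_ereal (A $ \<phi> j $ j) + y j < real_of_ereal (A $ \<phi> j $ k) + y k"
    by (rule divergent_columns_strict_rows[of A]) blast
  then obtain z where z: "z \<in> R_inf_vec" "unique_row_minima (transpose A) z"
    "distinct_min_columns (transpose A) z"
    "\<And>j. j \<in> ?J \<Longrightarrow> trop_finite ((transpose A \<odot> z) $ j)"
    by (rule dual_vector_of_strict_rows[OF assms, of ?J \<phi> y]) blast+
  have "trop_finite (ascent_limit A $ j)" if "j \<notin> ?J" for j
    using that ascent_limit_nonneg[of A j]
    by (cases "ascent_limit A $ j") (auto simp: trop_finite_def)
  then show thesis
    using z ascent_limit_in_R_inf_vec ascent_limit_solution[OF assms]
    by (intro that[of "ascent_limit A" z]) blast+
qed

text \<open>
  Weak duality excludes that both alternatives hold.  One complementary pair shows for both parts that one of them does: if the dual vector of the pair is finite nowhere on \<open>S\<close>, its solution is finite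
  on all of \<open>S\<close>, and if the dual vector is not finite on all of \<open>S\<close>, the solution is finite somewhere on \<open>S\<close>.
\<close>

theorem lemma14:
  fixes A :: "ereal ^ 'n ^ 'm" and S :: "'n set"
  assumes "A \<in> R_inf_mat"
  shows
    "((\<exists>x\<in>R_inf_vec. trop_solution A x \<and> (\<forall>i\<in>S. trop_finite (x $ i)))
      \<longleftrightarrow>
      \<not> (\<exists>z\<in>R_inf_vec. unique_row_minima (transpose A) z \<and> distinct_min_columns (transpose A) z \<and>
            (\<exists>i\<in>S. trop_finite ((transpose A \<odot> z) $ i))))
     \<and>
     ((\<exists>x\<in>R_inf_vec. trop_solution A x \<and> (\<exists>i\<in>S. trop_finite (x $ i)))
      \<longleftrightarrow>
      \<not> (\<exists>z\<in>R_inf_vec. unique_row_minima (transpose A) z \<and> distinct_min_columns (transpose A) z \<and>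
            (\<forall>i\<in>S. trop_finite ((transpose A \<odot> z) $ i))))"
proof -
  obtain x z where "x \<in> R_inf_vec" "trop_solution A x"
    "z \<in> R_inf_vec" "unique_row_minima (transpose A) z" "distinct_min_columns (transpose A) z"
    "\<And>j. trop_finite (x $ j) \<or> trop_finite ((transpose A \<odot> z) $ j)"
    using complementary_witnesses[OF assms] by blast
  then show ?thesis
    using no_common_finite_coordinate[OF assms] by (intro conjI iffI notI) blast+
qed

end
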